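(* For any analytic stability data $\sigma\in \mathrm{Stab}(\mathrm{Vect}_\Gamma)$ there exists an open neighborhood of $\sigma$ in the space $\mathrm{Stab}(\mathrm{Vect}_\Gamma)$ consisting of analytic stability data only.
   Context: Let $\Gamma$ be a free abelian group of finite rank $n$, $\Gamma_{\mathbb{R}}=\Gamma\otimes\mathbb{R}$, and $\mathfrak{g}=\mathrm{Vect}_\Gamma=\bigoplus_{\gamma}\mathfrak{g}_\gamma$ the $\Gamma$-graded complex Lie algebra of algebraic vector fields on the torus $\mathbf{T}_\Gamma=\mathrm{Hom}(\Gamma,\mathbb{C}^* )$ with monomials $x^\gamma$; $\mathfrak{g}_\gamma$ is spanned by $x^\gamma x_i\partial_{x_i}$, $1\le i\le n$. Sectors and groups. An admissible sector is $V=\{re^{i\theta}: r>0,\theta\in S\}\subset\mathbb{R}^2=\mathbb{C}$, $S\subset\mathbb{R}$ non-empty connected of length $<\pi$ (strict case), or an open interval of length $\pi$ (open half-plane); $V$ is open/closed/semiclosed if $S$ is. A strict cone is one containing no straight line. For a closed strict convex cone $C\subset\Gamma_{\mathbb{R}}$: $\mathfrak{g}_C=\prod_{\gamma\in C\cap\Gamma-\{0\}}\mathfrak{g}_\gamma$, $G_C=\exp(\mathfrak{g}_C)$. For a homomorphism $Z:\Gamma\to\mathbb{C}$ (central charge), with $\mathbb{R}$-linear extension $Z_{\mathbb{R}}$, and an open admissible $V$: $G_V=G_{V,Z}=\varinjlim_C G_C$ over closed strict convex cones $C$ with $Z_{\mathbb{R}}(C-\{0\})\subset V$ and $C\cap\mathrm{Ker}\,Z_{\mathbb{R}}=\{0\}$.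 Stability data. Stability data $\sigma$ on $\mathfrak{g}$ are a central charge $Z$ and elements $a(\gamma)\in\mathfrak{g}_\gamma$, $\gamma\in\Gamma-\{0\}$, such that there is a non-trivial quadratic form $Q$ on $\Gamma_{\mathbb{R}}$, negative definite on $\mathrm{Ker}\,Z_{\mathbb{R}}$, with $Q(\gamma)\ge 0$ whenever $a(\gamma)\ne0$. $\mathrm{Stab}(\mathfrak{g})$ is the set of all stability data. For a ray $l$ (vertex $0$ removed) $A_l=\exp\bigl(\sum_{Z(\gamma)\in l}a(\gamma)\bigr)$, and for a strict admissible sector $V$, $A_V=\prod_{l\subset V}A_l$ is the clockwise ordered product over rays $l\subset V$, an element of $G_C$ with $C$ the closed convex hull of $\{u: Q(u)\ge0, Z_{\mathbb{R}}(u)\in V\}$. Cyclic covers and representatives. An open cyclic cover of $\mathbb{R}^2-\{0\}$ is a family $(V_i)_{i\in J}$, $J$ a finite cyclically ordered set, of open admissible sectors covering $\mathbb{R}^2-\{0\}$ and going once around clockwise: with $\theta_j^\pm$ the angles (increasing clockwise) of the right ($+$) and left ($-$) boundary rays of $V_j$, $\theta_j^-\le\theta_{j+1}^-\le\theta_j^+\le\theta_{j+1}^+$ and $V_j\cap V_{j+1}\neq\emptyset$. For fixed $Z$, $\mathcal{M}_{(V_i)}$ is the quotient set of $\prod_{i\in J}G_{V_i}$ by the free action of $\prod_{i\in J}G_{V_i\cap V_{i+1}}$, where $h\in G_{V_i\cap V_{i+1}}$ acts by $(g_i,g_{i+1})\mapsto(g_ih^{-1},hg_{i+1})$. The set of stability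 data with central charge $Z$ is identified with $\mathcal{M}_{(V_i)}$: to $\sigma$ corresponds the class of $(A_{V_i'})_{i\in J}$ for any clockwise ordered disjoint decomposition $\mathbb{R}^2-\{0\}=\bigsqcup_i V_i'$ into semiclosed admissible sectors with closures (in $\mathbb{R}^2-\{0\}$) contained in $V_i$. Any element of this class is called a representative $(g_{V_i})_{i\in J}$ of $\sigma$. Topology on $\mathrm{Stab}(\mathfrak{g})$. Let $\sigma$ have central charge $Z$ and a representative $(g_{V_i})$, with $g_{V_i}\in G_{C_i}$, $C_i$ closed strict convex cones with $Z_{\mathbb{R}}(C_i-\{0\})\subset V_i$. For $Z'$ close to $Z$ one still has $Z'_{\mathbb{R}}(C_i-\{0\})\subset V_i$, so $(g_{V_i})$ represents stability data with central charge $Z'$. A basis of neighborhoods of $\sigma$ consists of the sets of all such stability data (same representative) with $Z'$ ranging over members of a basis of small neighborhoods of $Z$ in $\mathrm{Hom}(\Gamma,\mathbb{C})$. Analyticity. A series $\sum_{\mu\in C\cap\Gamma}c_\mu x^\mu$ ($C$ closed strict convex) is analytic if it converges absolutely at some point of $\mathbf{T}_\Gamma$. An element $g\in G_C$ is analytic if the series $g(x^\gamma)/x^\gamma=1+\sum_{\mu\in C\cap\Gamma-\{0\}}c_{\gamma\mu}x^\mu$ is analytic for all $\gamma\in\Gamma$; an element of $G_V$ is analytic if it is the image of an analytic element of some $G_C$ in the limit. Stability data $\sigma$ are called analytic if there exist an open cyclic cover $(V_i)_{i\in J}$ and a representative $(g_{V_i})_{i\in J}$ of $\sigma$ with all $g_{V_i}$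 analytic. *)

theory Defs
  imports "HOL-Analysis.Analysis" "HOL-Algebra.Group" "HOL-Library.Groups_Big_Fun"
begin

text \<open>
  The free abelian group \<open>\<Gamma>\<close> of rank \<open>n\<close> is \<open>\<int>\<^sup>n\<close>, and \<open>\<Gamma>\<^sub>\<real> = \<real>\<^sup>n\<close>.  A central charge,
  that is a homomorphism \<open>\<Gamma> \<rightarrow> \<complex>\<close>, is given by its values on the standard basis, so that
  \<open>Hom(\<Gamma>, \<complex>) = \<complex>\<^sup>n\<close> also as a topological space.
\<close>

type_synonym 'n lattice = "(int, 'n) vec"

definition real_vec :: "'n::finite lattice \<Rightarrow> real ^ 'n" where
  "real_vec \<gamma> = (\<chi> i. of_int (\<gamma> $ i))"

definition charge :: "complex ^ 'n::finite \<Rightarrow> real ^ 'n \<Rightarrow> complex" where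
  "charge Z u = (\<Sum>i\<in>UNIV. u $ i *\<^sub>R Z $ i)"

text \<open>
  A possibly infinite sum of homogeneous vector fields is a function \<open>\<xi>\<close> assigning to \<open>\<gamma>\<close> the
  vector \<open>\<xi> \<gamma>\<close> that stands for \<open>x\<^sup>\<gamma> (\<Sum>i. (\<xi> \<gamma>)\<^sub>i x\<^sub>i \<partial>\<^sub>i)\<close>, an element of \<open>\<gg>\<^sub>\<gamma>\<close>.

  An operator \<open>T\<close> on formal series is given by its values on monomials: \<open>T \<gamma> \<nu>\<close> is the
  coefficient of \<open>x\<^sup>\<nu>\<close> in \<open>T(x\<^sup>\<gamma>)\<close>.  Vector fields act as derivations, and this action is
  faithful, so the pronilpotent group \<open>exp \<gg>\<^sub>C\<close> is the group of operators \<open>exp \<xi>\<close> under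
  composition.  For operators coming from one strict cone every \<open>Sum_any\<close> below has
  finitely many nonzero terms.
\<close>

type_synonym 'n vector_field = "'n lattice \<Rightarrow> (complex, 'n) vec"

type_synonym 'n operator = "'n lattice \<Rightarrow> 'n lattice \<Rightarrow> complex"

text \<open>The coefficient vector \<open>\<xi> \<mu>\<close> sends \<open>x\<^sup>\<gamma>\<close> to \<open>(\<Sum>i. (\<xi> \<mu>)\<^sub>i \<gamma>\<^sub>i) x\<^sup>\<gamma>\<^sup>+\<^sup>\<mu>\<close>.\<close>

definition derivation :: "'n::finite vector_field \<Rightarrow> 'n operator" where
  "derivation \<xi> \<gamma> \<nu> = (\<Sum>i\<in>UNIV. \<xi> (\<nu> - \<gamma>) $ i * of_int (\<gamma> $ i))"

definition op_one :: "'n::finite operator" where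
  "op_one \<gamma> \<nu> = (if \<nu> = \<gamma> then 1 else 0)"

text \<open>\<open>op_mult S T\<close> is \<open>S \<circ> T\<close>: first \<open>T\<close>, then \<open>S\<close>.\<close>

definition op_mult :: "'n::finite operator \<Rightarrow> 'n operator \<Rightarrow> 'n operator" where
  "op_mult S T \<gamma> \<nu> = Sum_any (\<lambda>\<kappa>. T \<gamma> \<kappa> * S \<kappa> \<nu>)"

definition op_exp :: "'n::finite operator \<Rightarrow> 'n operator" where
  "op_exp T \<gamma> \<nu> = Sum_any (\<lambda>k::nat. ((op_mult T ^^ k) op_one) \<gamma> \<nu> / fact k)"

definition sector :: "real set \<Rightarrow> complex set" where
  "sector S = {of_real r * cis \<theta> | r \<theta>. r > 0 \<and> \<theta> \<in> S}"

definition admissible :: "real set \<Rightarrow> bool" where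
  "admissible S \<longleftrightarrow>
     (S \<noteq> {} \<and> connected S \<and> bounded S \<and> diameter S < pi) \<or> (\<exists>a. S = {a<..<a + pi})"

definition strict_cone :: "(real ^ 'n::finite) set \<Rightarrow> bool" where
  "strict_cone C \<longleftrightarrow> C \<noteq> {} \<and> closed C \<and> convex C \<and> cone C \<and>
     \<not> (\<exists>a v. v \<noteq> 0 \<and> (\<forall>t. a + t *\<^sub>R v \<in> C))"

definition lie_algebra_cone :: "(real ^ 'n::finite) set \<Rightarrow> 'n vector_field set" where
  "lie_algebra_cone C = {\<xi>. \<forall>\<gamma>. \<xi> \<gamma> \<noteq> 0 \<longrightarrow> real_vec \<gamma> \<in> C \<and> \<gamma> \<noteq> 0}"

definition group_cone :: "(real ^ 'n::finite) set \<Rightarrow> 'n operator monoid" where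
  "group_cone C = \<lparr>carrier = (\<lambda>\<xi>. op_exp (derivation \<xi>)) ` lie_algebra_cone C,
                   mult = op_mult, one = op_one\<rparr>"

definition cone_in_sector ::
    "complex ^ 'n::finite \<Rightarrow> complex set \<Rightarrow> (real ^ 'n) set \<Rightarrow> bool" where
  "cone_in_sector Z V C \<longleftrightarrow>
     strict_cone C \<and> charge Z ` (C - {0}) \<subseteq> V \<and> C \<inter> {u. charge Z u = 0} = {0}"

text \<open>
  For \<open>C \<subseteq> C'\<close> the transition map of the direct system is the inclusion of one set of
  operators into another, so the direct limit is the union.
\<close>

definition group_sector :: "complex ^ 'n::finite \<Rightarrow> complex set \<Rightarrow> 'n operator monoid" where
  "group_sector Z V = \<lparr>carrier = (\<Union>C \<in> {C. cone_in_sector Z V C}. carrier (group_cone C)),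
                       mult = op_mult, one = op_one\<rparr>"

definition quadratic_form :: "(real ^ 'n::finite \<Rightarrow> real) \<Rightarrow> bool" where
  "quadratic_form Q \<longleftrightarrow> (\<exists>B. bilinear B \<and> (\<forall>u v. B u v = B v u) \<and> Q = (\<lambda>u. B u u))"

text \<open>
  The family \<open>(a \<gamma>)\<close> is indexed by \<open>\<gamma> \<noteq> 0\<close>; the value at \<open>0\<close> is normalised to \<open>0\<close>.
\<close>

type_synonym 'n stability = "(complex, 'n) vec \<times> 'n vector_field"

definition Stab :: "'n::finite stability set" where
  "Stab = {(Z, a). a 0 = 0 \<and>
     (\<exists>Q. quadratic_form Q \<and> (\<exists>u. Q u \<noteq> 0) \<and>
          (\<forall>u. charge Z u = 0 \<and> u \<noteq> 0 \<longrightarrow> Q u < 0) \<and>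
          (\<forall>\<gamma>. a \<gamma> \<noteq> 0 \<longrightarrow> Q (real_vec \<gamma>) \<ge> 0))}"

definition ray_element :: "'n::finite stability \<Rightarrow> complex set \<Rightarrow> 'n operator" where
  "ray_element \<sigma> l =
     op_exp (derivation (\<lambda>\<gamma>. if charge (fst \<sigma>) (real_vec \<gamma>) \<in> l then snd \<sigma> \<gamma> else 0))"

text \<open>
  In the product over finitely many rays the factors are listed clockwise, that is by decreasing
  angle, from left to right.  The product over all rays of \<open>sector S\<close> is the limit over finite
  sets of rays in the pronilpotent topology: each coefficient is eventually constant.
\<close>

definition finite_ray_product :: "'n::finite stability \<Rightarrow> real set \<Rightarrow> 'n operator" where
  "finite_ray_product \<sigma> F =
     foldr op_mult (map (\<lambda>\<theta>. ray_element \<sigma> (sector {\<theta>})) (rev (sorted_list_of_set F))) op_one"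

definition sector_element :: "'n::finite stability \<Rightarrow> real set \<Rightarrow> 'n operator" where
  "sector_element \<sigma> S \<gamma> \<nu> =
     (THE c. \<forall>\<^sub>F F in finite_subsets_at_top S. finite_ray_product \<sigma> F \<gamma> \<nu> = c)"

text \<open>
  The index set is \<open>{..<m}\<close> with its cyclic order.  The angles \<open>\<theta>m j\<close> and \<open>\<theta>p j\<close> of the left
  and right boundary rays increase clockwise, hence the signs; they are extended to all \<open>j\<close>
  by \<open>2 * pi\<close> per period, which expresses that the cover goes once around.
\<close>

definition open_cyclic_cover :: "nat \<Rightarrow> (nat \<Rightarrow> complex set) \<Rightarrow> bool" where
  "open_cyclic_cover m V \<longleftrightarrow>
     (\<exists>\<theta>m \<theta>p :: nat \<Rightarrow> real.
        (\<forall>j. \<theta>m (j + m) = \<theta>m j + 2 * pi \<and> \<theta>p (j + m) = \<theta>p j + 2 * pi) \<and>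
        (\<forall>j. admissible {- \<theta>p j<..<- \<theta>m j} \<and> V j = sector {- \<theta>p j<..<- \<theta>m j}) \<and>
        (\<forall>j. \<theta>m j \<le> \<theta>m (Suc j) \<and> \<theta>m (Suc j) \<le> \<theta>p j \<and> \<theta>p j \<le> \<theta>p (Suc j))) \<and>
     (\<forall>j. V j \<inter> V (Suc j) \<noteq> {}) \<and>
     (\<Union>j<m. V j) = - {0}"

definition cyclic_decomposition ::
    "nat \<Rightarrow> (nat \<Rightarrow> complex set) \<Rightarrow> (nat \<Rightarrow> real set) \<Rightarrow> bool" where
  "cyclic_decomposition m V S \<longleftrightarrow>
     (\<exists>t :: nat \<Rightarrow> real. t m = t 0 + 2 * pi \<and>
        (\<forall>j<m. t j < t (Suc j) \<and>
               (S j = {- t (Suc j)..<- t j} \<or> S j = {- t (Suc j)<..- t j}))) \<and>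
     (\<forall>j<m. admissible (S j)) \<and>
     disjoint_family_on (\<lambda>j. sector (S j)) {..<m} \<and>
     (\<Union>j<m. sector (S j)) = - {0} \<and>
     (\<forall>j<m. closure (sector (S j)) - {0} \<subseteq> V j)"

definition group_family ::
    "complex ^ 'n::finite \<Rightarrow> nat \<Rightarrow> (nat \<Rightarrow> complex set) \<Rightarrow> (nat \<Rightarrow> 'n operator) set" where
  "group_family Z m V = (\<Pi> j\<in>{..<m}. carrier (group_sector Z (V j)))"

text \<open>
  Two families have the same class in \<open>\<M>\<^sub>V\<close> if they differ by the action of some \<open>h\<close>.  The component
  \<open>h j\<close>, attached to \<open>V j \<inter> V (Suc j)\<close>, changes \<open>g j\<close> to \<open>g j (h j)\<^sup>-\<^sup>1\<close> and its cyclic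
  successor \<open>g'\<close> to \<open>h j g'\<close>.
\<close>

definition same_class ::
    "complex ^ 'n::finite \<Rightarrow> nat \<Rightarrow> (nat \<Rightarrow> complex set) \<Rightarrow>
     (nat \<Rightarrow> 'n operator) \<Rightarrow> (nat \<Rightarrow> 'n operator) \<Rightarrow> bool" where
  "same_class Z m V f g \<longleftrightarrow> f \<in> group_family Z m V \<and> g \<in> group_family Z m V \<and>
     (\<exists>h \<in> group_family Z m (\<lambda>j. V j \<inter> V (Suc j)). \<forall>j<m.
        g j = op_mult (op_mult (h (if j = 0 then m - 1 else j - 1)) (f j))
                (inv\<^bsub>group_sector Z (V j \<inter> V (Suc j))\<^esub> (h j)))"

definition representative ::
    "'n::finite stability \<Rightarrow> nat \<Rightarrow> (nat \<Rightarrow> complex set) \<Rightarrow> (nat \<Rightarrow> 'n operator) \<Rightarrow> bool" where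
  "representative \<sigma> m V g \<longleftrightarrow>
     (\<exists>S. cyclic_decomposition m V S \<and>
          same_class (fst \<sigma>) m V (\<lambda>j. sector_element \<sigma> (S j)) g)"

text \<open>
  \<open>stab_nhd U m V g\<close> is the set of stability data represented by \<open>g\<close> whose central charge lies
  in \<open>U\<close>.  For \<open>U\<close> open and small, it is a basic neighbourhood of each of its elements, so
  the topology having these sets as neighbourhood bases is the one that they generate.
\<close>

definition stab_nhd ::
    "(complex ^ 'n::finite) set \<Rightarrow> nat \<Rightarrow> (nat \<Rightarrow> complex set) \<Rightarrow> (nat \<Rightarrow> 'n operator) \<Rightarrow>
     'n stability set" where
  "stab_nhd U m V g = {\<tau> \<in> Stab. fst \<tau> \<in> U \<and> representative \<tau> m V g}"

definition basic_nhds :: "'n::finite stability \<Rightarrow> 'n stability set set" where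
  "basic_nhds \<sigma> = {stab_nhd U m V g | U m V g.
     open_cyclic_cover m V \<and> representative \<sigma> m V g \<and>
     open U \<and> fst \<sigma> \<in> U \<and>
     (\<exists>C. \<forall>j<m. g j \<in> carrier (group_cone (C j)) \<and> cone_in_sector (fst \<sigma>) (V j) (C j) \<and>
                (\<forall>Z'\<in>U. charge Z' ` (C j - {0}) \<subseteq> V j))}"

definition stab_topology :: "'n::finite stability topology" where
  "stab_topology = topology_generated_by (\<Union>\<sigma>\<in>Stab. basic_nhds \<sigma>)"

text \<open>Points of the torus \<open>Hom(\<Gamma>, \<complex>\<^sup>*)\<close> in coordinates, and monomials evaluated there.\<close>

definition torus :: "(complex ^ 'n::finite) set" where
  "torus = {x. \<forall>i. x $ i \<noteq> 0}"

definition monomial_at :: "complex ^ 'n::finite \<Rightarrow> 'n lattice \<Rightarrow> complex" where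
  "monomial_at x \<mu> = (\<Prod>i\<in>UNIV. x $ i powi (\<mu> $ i))"

definition analytic_series :: "(real ^ 'n::finite) set \<Rightarrow> ('n lattice \<Rightarrow> complex) \<Rightarrow> bool" where
  "analytic_series C c \<longleftrightarrow>
     (\<exists>x\<in>torus. (\<lambda>\<mu>. norm (c \<mu> * monomial_at x \<mu>)) summable_on {\<mu>. real_vec \<mu> \<in> C})"

text \<open>The coefficient of \<open>x\<^sup>\<mu>\<close> in \<open>g(x\<^sup>\<gamma>) / x\<^sup>\<gamma>\<close> is \<open>g \<gamma> (\<gamma> + \<mu>)\<close>.\<close>

definition analytic_cone :: "(real ^ 'n::finite) set \<Rightarrow> 'n operator \<Rightarrow> bool" where
  "analytic_cone C g \<longleftrightarrow> g \<in> carrier (group_cone C) \<and>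
     (\<forall>\<gamma>. analytic_series C (\<lambda>\<mu>. g \<gamma> (\<gamma> + \<mu>)))"

definition analytic_sector ::
    "complex ^ 'n::finite \<Rightarrow> complex set \<Rightarrow> 'n operator \<Rightarrow> bool" where
  "analytic_sector Z V g \<longleftrightarrow> (\<exists>C. cone_in_sector Z V C \<and> analytic_cone C g)"

definition analytic_stability :: "'n::finite stability \<Rightarrow> bool" where
  "analytic_stability \<sigma> \<longleftrightarrow>
     (\<exists>m V g. open_cyclic_cover m V \<and> representative \<sigma> m V g \<and>
              (\<forall>j<m. analytic_sector (fst \<sigma>) (V j) (g j)))"

end

theory Submission
  imports Defs
begin

text \<open>
  The cones \<open>C\<^sub>j\<close> that carry an analytic representative may be kept while the central charge moves:
  \<open>C\<^sub>j\<close> meets the unit sphere in a compact set, which every charge close to \<open>Z\<close> still maps into the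
  open sector \<open>V\<^sub>j\<close>.  Analyticity of \<open>g \<in> G\<^sub>C\<close> involves only \<open>g\<close> and \<open>C\<close>, so the same
  representative shows that all data in this basic neighbourhood are analytic.
\<close>

lemma zero_notin_sector: "0 \<notin> sector S"
  by (auto simp: sector_def)

lemma sector_scaleR:
  assumes "z \<in> sector S" "r > 0"
  shows "r *\<^sub>R z \<in> sector S"
proof -
  obtain s \<theta> where "s > 0" "\<theta> \<in> S" "z = of_real s * cis \<theta>"
    using assms(1) by (auto simp: sector_def)
  then have "r *\<^sub>R z = of_real (r * s) * cis \<theta>" "r * s > 0" "\<theta> \<in> S"
    using assms(2) by (auto simp: scaleR_conv_of_real)
  then show ?thesis
    unfolding sector_def by blast
qed

text \<open>Near \<open>z\<close> the angle of \<open>w\<close> can be followed continuously as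
  \<theta> + \<open>Arg (w / z)\<close>. Dividing by \<open>z\<close> brings the argument close to
  1, away from the branch cut of \<open>Arg\<close>, wherever \<open>z\<close> lies.\<close>

lemma open_sector:
  assumes "open S"
  shows "open (sector S)"
proof (rule openI)
  fix z assume "z \<in> sector S"
  then obtain r \<theta> where z: "r > 0" "\<theta> \<in> S" "z = of_real r * cis \<theta>"
    by (auto simp: sector_def)
  then have "z \<noteq> 0"
    by auto
  have "isCont (\<lambda>w. \<theta> + Arg (w / z)) z"
    using \<open>z \<noteq> 0\<close> by (intro continuous_intros isCont_o2[OF _ continuous_at_Arg]) auto
  \<comment> \<open>Continuity gives a limit at punctured neighbourhoods only; since
    \<open>Arg 1 = 0\<close>, the value at \<open>z\<close> is \<theta> itself, so the limit holds
    along \<open>nhds z\<close>.\<close>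
  then have "((\<lambda>w. \<theta> + Arg (w / z)) \<longlongrightarrow> \<theta>) (nhds z)"
    using \<open>z \<noteq> 0\<close> tendsto_at_iff_tendsto_nhds[of "\<lambda>w. \<theta> + Arg (w / z)" z] by (simp add: isCont_def)
  then have "\<forall>\<^sub>F w in nhds z. \<theta> + Arg (w / z) \<in> S"
    using assms z(2) by (rule topological_tendstoD)
  moreover have "\<forall>\<^sub>F w in nhds z. w \<noteq> 0"
    using \<open>z \<noteq> 0\<close> t1_space_nhds by blast
  ultimately have "\<forall>\<^sub>F w in nhds z. w \<in> sector S"
  proof eventually_elim
    case (elim w)
    have "w = z * (w / z)"
      using \<open>z \<noteq> 0\<close> by simp
    also have "w / z = of_real (norm (w / z)) * cis (Arg (w / z))"
      by (metis rcis_cmod_Arg rcis_def)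
    finally have "w = of_real (r * norm (w / z)) * cis (\<theta> + Arg (w / z))"
      using z(3) by (simp add: cis_mult[symmetric] mult_ac)
    moreover have "r * norm (w / z) > 0"
      using z(1) elim(2) \<open>z \<noteq> 0\<close> by simp
    ultimately show ?case
      using elim(1) unfolding sector_def by blast
  qed
  then show "\<exists>e>0. ball z e \<subseteq> sector S"
    by (simp add: eventually_nhds_metric subset_eq Ball_def dist_commute)
qed

lemma charge_scaleR: "charge Z (r *\<^sub>R u) = r *\<^sub>R charge Z u"
  by (simp add: charge_def scaleR_sum_right)

text \<open>The charge is linear in \<open>Z\<close>, and each of the \<open>CARD('n)\<close>
  coordinates contributes at most \<open>norm u * norm (Z' - Z)\<close>. On unit vectors the bound
  is uniform in \<open>u\<close>.\<close>

lemma norm_charge_diff_le: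
  fixes Z Z' :: "complex ^ 'n::finite"
  shows "norm (charge Z' u - charge Z u) \<le> real CARD('n) * norm u * norm (Z' - Z)"
proof -
  have "charge Z' u - charge Z u = (\<Sum>i\<in>UNIV. u $ i *\<^sub>R (Z' - Z) $ i)"
    by (simp add: charge_def sum_subtractf scaleR_diff_right)
  also have "norm \<dots> \<le> (\<Sum>i\<in>(UNIV :: 'n set). norm u * norm (Z' - Z))"
  proof (rule sum_norm_le)
    fix i
    have "norm (u $ i *\<^sub>R (Z' - Z) $ i) = \<bar>u $ i\<bar> * norm ((Z' - Z) $ i)"
      by (rule norm_scaleR)
    also have "\<dots> \<le> norm u * norm (Z' - Z)"
      by (intro mult_mono component_le_norm_cart Finite_Cartesian_Product.norm_nth_le) auto
    finally show "norm (u $ i *\<^sub>R (Z' - Z) $ i) \<le> norm u * norm (Z' - Z)" .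
  qed
  finally show ?thesis
    by simp
qed

text \<open>The cone and the sector are both invariant under positive scaling, so it is enough to
  control the charges of unit vectors.\<close>

lemma cone_in_sector_stable:
  fixes Z :: "complex ^ 'n::finite"
  assumes C: "cone_in_sector Z (sector S) C" and "open S"
  obtains e where "e > 0" "\<And>Z'. Z' \<in> ball Z e \<Longrightarrow> cone_in_sector Z' (sector S) C"
proof -
  define K where "K = C \<inter> sphere 0 1"
  have cone: "closed C" "cone C" and sub: "charge Z ` (C - {0}) \<subseteq> sector S"
    and "0 \<in> C"
    using C by (auto simp: cone_in_sector_def strict_cone_def)
  have "compact K"
    unfolding K_def using cone by (simp add: closed_Int_compact)
  moreover have "continuous_on K (charge Z)"
    unfolding charge_def by (intro continuous_intros)
  ultimately have "compact (charge Z ` K)"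
    by (rule compact_continuous_image[rotated])
  moreover have "charge Z ` K \<subseteq> sector S"
    using sub by (force simp: K_def)
  \<comment> \<open>Compactness yields one margin \<open>d\<close> that serves all unit vectors of
    the cone.\<close>
  ultimately obtain d where d: "d > 0" "(\<Union>z\<in>charge Z ` K. ball z d) \<subseteq> sector S"
    using open_sector[OF \<open>open S\<close>] compact_subset_open_imp_ball_epsilon_subset by metis
  show thesis
  proof
    \<comment> \<open>With this radius the charge of a unit vector moves by less than
      \<open>d\<close>.\<close>
    show "d / real CARD('n) > 0"
      using d(1) by simp
    fix Z' assume "Z' \<in> ball Z (d / real CARD('n))"
    then have small: "real CARD('n) * norm (Z' - Z) < d"
      by (simp add: dist_norm norm_minus_commute field_simps)
    have "charge Z' u \<in> sector S" if u: "u \<in> C - {0}" for u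
    proof -
      define v where "v = (1 / norm u) *\<^sub>R u"
      have v: "v \<in> K" "norm v = 1" "u = norm u *\<^sub>R v"
        using u cone by (auto simp: v_def K_def cone_def)
      have "charge Z' v \<in> ball (charge Z v) d"
        using norm_charge_diff_le[of Z' v Z] small v(2) by (simp add: dist_norm norm_minus_commute)
      then have "charge Z' v \<in> sector S"
        using d(2) v(1) by blast
      then show ?thesis
        using sector_scaleR[of _ S "norm u"] u v(3)
        by (metis Diff_iff charge_scaleR insertI1 zero_less_norm_iff)
    qed
    then have image: "charge Z' ` (C - {0}) \<subseteq> sector S"
      by blast
    \<comment> \<open>The kernel condition comes for free: nonzero vectors of \<open>C\<close> have
      charge in the sector, which omits 0.\<close>
    have "charge Z' 0 = 0"
      by (simp add: charge_def)
    then have "C \<inter> {u. charge Z' u = 0} = {0}"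
      using image \<open>0 \<in> C\<close> zero_notin_sector[of S] by force
    with image show "cone_in_sector Z' (sector S) C"
      using C unfolding cone_in_sector_def by blast
  qed
qed

theorem proposition3p5p1:
  fixes \<sigma> :: "'n::finite stability"
  assumes "\<sigma> \<in> Stab"
    and "analytic_stability \<sigma>"
  shows "\<exists>U. openin stab_topology U \<and> \<sigma> \<in> U \<and> U \<subseteq> {\<tau> \<in> Stab. analytic_stability \<tau>}"
proof -
  obtain m V g where cover: "open_cyclic_cover m V" and rep: "representative \<sigma> m V g"
    and "\<forall>j<m. analytic_sector (fst \<sigma>) (V j) (g j)"
    using assms(2) unfolding analytic_stability_def by blast
  then obtain C where C: "\<And>j. j < m \<Longrightarrow> cone_in_sector (fst \<sigma>) (V j) (C j)"
      "\<And>j. j < m \<Longrightarrow> analytic_cone (C j) (g j)"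
    unfolding analytic_sector_def by metis
  \<comment> \<open>The members of a cover are sectors over open intervals of angles, as the
    stability of cones demands.\<close>
  have "\<exists>S. open S \<and> V j = sector S" for j
    using cover unfolding open_cyclic_cover_def by (metis open_greaterThanLessThan)
  then have "\<exists>e>0. \<forall>Z'\<in>ball (fst \<sigma>) e. cone_in_sector Z' (V j) (C j)" if "j < m" for j
    using C(1)[OF that] cone_in_sector_stable by metis
  then obtain e where e: "\<And>j. j < m \<Longrightarrow> e j > 0"
      "\<And>j Z'. j < m \<Longrightarrow> Z' \<in> ball (fst \<sigma>) (e j) \<Longrightarrow> cone_in_sector Z' (V j) (C j)"
    by metis
  \<comment> \<open>Finitely many radii, one for each sector, so the intersection stays
    open.\<close>
  define U where "U = (\<Inter>j<m. ball (fst \<sigma>) (e j))"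
  have U: "open U" "fst \<sigma> \<in> U"
    using e(1) by (auto simp: U_def intro!: open_INT)
  have stable: "cone_in_sector Z' (V j) (C j)" if "j < m" "Z' \<in> U" for j Z'
    using e(2) that by (auto simp: U_def)
  have "stab_nhd U m V g \<in> basic_nhds \<sigma>"
  proof -
    have "\<forall>j<m. g j \<in> carrier (group_cone (C j)) \<and> cone_in_sector (fst \<sigma>) (V j) (C j) \<and>
            (\<forall>Z'\<in>U. charge Z' ` (C j - {0}) \<subseteq> V j)"
      using C stable unfolding analytic_cone_def cone_in_sector_def by blast
    then show ?thesis
      unfolding basic_nhds_def using cover rep U by blast
  qed
  then have "openin stab_topology (stab_nhd U m V g)"
    unfolding stab_topology_def using assms(1) by (intro topology_generated_by_Basis) blast
  moreover have "\<sigma> \<in> stab_nhd U m V g"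
    using assms(1) rep U by (simp add: stab_nhd_def)
  \<comment> \<open>Membership in \<open>stab_nhd\<close> includes that \<open>g\<close> represents
    \<tau>; what remains is the cone condition for the new charge, given by
    \<open>stable\<close>.\<close>
  moreover have "analytic_stability \<tau>" if "\<tau> \<in> stab_nhd U m V g" for \<tau>
    using that cover C(2) stable
    unfolding analytic_stability_def analytic_sector_def stab_nhd_def by blast
  ultimately show ?thesis
    unfolding stab_nhd_def by blast
qed

end
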